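(* Let $\Omega\subset\mathbb R^N$ be a bounded convex domain and $j\in\{1,\dots,N\}$. Then $\Omega\in\mathcal C_j$ if and only if $d(\Omega)\le N-j$.
   Context: A domain is a nonempty open connected set. A domain $\omega\subset\mathbb R^j$ is strictly convex if $(1-t)x+ty\in\omega$ for all $x\ne y$ in $\overline\omega$ and $0<t<1$. For $j\in\{1,\dots,N\}$ let $C_j$ be the collection of sets $C=\omega\times\mathbb R^{N-j}\subset\mathbb R^N$ with $\omega\subset\mathbb R^j$ a bounded strictly convex domain (located anywhere in $\mathbb R^j$). $\mathcal C_j$ is the class of bounded convex domains $\Omega\subset\mathbb R^N$ such that for each $x\in\partial\Omega$ there exist an orthogonal $N\times N$ matrix $O$ and $C\in C_j$ with $\Omega\subset OC$ and $x\in\partial(OC)$. For $x\in\partial\Omega$, $d_x(\Omega)$ is the maximum of the $m\in\{0,1,\dots,N-1\}$ such that there exist an $m$-dimensional linear subspace $V\subset\mathbb R^N$ and $\delta>0$ with $x+(V\cap B_\delta)\subset\partial\Omega$, where $B_\delta$ is the open ball of radius $\delta$ centered at the origin. Set $d(\Omega)=\max_{x\in\partial\Omega}d_x(\Omega)$. *)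

theory Defs
  imports "HOL-Analysis.Analysis"
begin

definition is_domain :: "'a::topological_space set \<Rightarrow> bool" where
  "is_domain S \<longleftrightarrow> S \<noteq> {} \<and> open S \<and> connected S"

definition strictly_convex :: "'a::real_normed_vector set \<Rightarrow> bool" where
  "strictly_convex S \<longleftrightarrow>
     (\<forall>x\<in>closure S. \<forall>y\<in>closure S. \<forall>t. x \<noteq> y \<and> 0 < t \<and> t < 1 \<longrightarrow> (1 - t) *\<^sub>R x + t *\<^sub>R y \<in> S)"

(* The dimensions are N = CARD('n) and j = CARD('j). An injection \<iota> from 'j to 'n selects
   the j coordinates of R^N that form the factor R^j in the splitting R^N = R^j x R^(N-j);
   the remaining N - j coordinates are free. No type is needed for R^(N-j), so j = N is
   included. *)

definition cylinder :: "('j::finite \<Rightarrow> 'n::finite) \<Rightarrow> (real ^ 'j) set \<Rightarrow> (real ^ 'n) set" where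
  "cylinder \<iota> \<omega> = {x. (\<chi> i. x $ \<iota> i) \<in> \<omega>}"

definition model_cylinders :: "('j::finite \<Rightarrow> 'n::finite) \<Rightarrow> (real ^ 'n) set set" where
  "model_cylinders \<iota> =
     {cylinder \<iota> \<omega> |\<omega>. is_domain \<omega> \<and> bounded \<omega> \<and> strictly_convex \<omega>}"

definition cylinder_class :: "('j::finite \<Rightarrow> 'n::finite) \<Rightarrow> (real ^ 'n) set set" where
  "cylinder_class \<iota> =
     {\<Omega>. is_domain \<Omega> \<and> bounded \<Omega> \<and> convex \<Omega> \<and>
        (\<forall>x\<in>frontier \<Omega>. \<exists>U :: real ^ 'n ^ 'n. \<exists>C\<in>model_cylinders \<iota>.
           orthogonal_matrix U \<and> \<Omega> \<subseteq> (*v) U ` C \<and> x \<in> frontier ((*v) U ` C))}"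

(* Max is taken over a finite set, which is nonempty when x lies on the frontier
   (m = 0 and V = {0} qualify). *)

definition flat_dim_at :: "(real ^ 'n::finite) set \<Rightarrow> real ^ 'n \<Rightarrow> nat" where
  "flat_dim_at \<Omega> x =
     Max {m. m \<le> CARD('n) - 1 \<and>
        (\<exists>V \<delta>. subspace V \<and> dim V = m \<and> 0 < \<delta> \<and>
           (\<lambda>v. x + v) ` (V \<inter> ball 0 \<delta>) \<subseteq> frontier \<Omega>)}"

(* The image is a finite set; it is nonempty when \<Omega> is nonempty, bounded and open,
   because then the frontier is nonempty. *)

definition flat_dim :: "(real ^ 'n::finite) set \<Rightarrow> nat" where
  "flat_dim \<Omega> = Max (flat_dim_at \<Omega> ` frontier \<Omega>)"

end

theory Submission
  imports Defs
begin

text \<open>If \<open>\<Omega>\<close> lies in a rotated cylinder over \<open>\<omega>\<close> and \<open>x\<close> is a common frontier point, then a flat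
  piece of \<open>frontier \<Omega>\<close> centred at \<open>x\<close> projects into \<open>closure \<omega>\<close> with \<open>x\<close> going to a point outside \<open>\<omega>\<close>;
  by strict convexity its directions lie in the kernel of the projection, of dimension \<open>N - j\<close>.

  Conversely, a supporting hyperplane at \<open>x\<close> cuts \<open>closure \<Omega>\<close> in a face, which has dimension at most
  \<open>N - j\<close> because of its relative interior points. Project orthogonally to a \<open>j\<close>-dimensional space
  that contains the normal of the hyperplane and is orthogonal to the face. The face
  collapses to one point, so the image of \<open>x\<close> is an exposed point of the projected body, and an
  exposed point of a compact set is a frontier point of some bounded strictly convex domain
  containing the rest of the set.\<close>

section \<open>Exposed points and strictly convex domains\<close>

text \<open>After squaring, the gap between the two sides is \<open>t * (1 - t)\<close> times the
  square of \<open>sqrt a - sqrt b\<close>, which is positive because \<open>a\<close> and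
  \<open>b\<close> differ.\<close>

lemma sqrt_strictly_concave:
  fixes a b t :: real
  assumes "0 \<le> a" "0 \<le> b" "a \<noteq> b" "0 < t" "t < 1"
  shows "(1 - t) * sqrt a + t * sqrt b < sqrt ((1 - t) * a + t * b)"
proof (rule real_less_rsqrt)
  have "(1 - t) * (sqrt a)\<^sup>2 + t * (sqrt b)\<^sup>2 - ((1 - t) * sqrt a + t * sqrt b)\<^sup>2
      = t * (1 - t) * (sqrt a - sqrt b)\<^sup>2"
    by algebra
  moreover have "t * (1 - t) * (sqrt a - sqrt b)\<^sup>2 > 0"
    using assms by simp
  moreover have "(sqrt a)\<^sup>2 = a" "(sqrt b)\<^sup>2 = b"
    using assms by simp_all
  ultimately show "((1 - t) * sqrt a + t * sqrt b)\<^sup>2 < (1 - t) * a + t * b"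
    by (metis diff_gt_0_iff_gt)
qed

text \<open>Strict convexity of the Euclidean ball: the squared norm of the combination falls short
  of the combination of the squared norms by \<open>t * (1 - t)\<close> times the squared distance
  of the points.\<close>

lemma norm_convex_combination_less:
  fixes x y :: "'a::real_inner"
  assumes "norm x \<le> r" "norm y \<le> r" "x \<noteq> y" "0 < t" "t < 1"
  shows "norm ((1 - t) *\<^sub>R x + t *\<^sub>R y) < r"
proof (rule power2_less_imp_less)
  have "(norm ((1 - t) *\<^sub>R x + t *\<^sub>R y))\<^sup>2
      = (1 - t) * (norm x)\<^sup>2 + t * (norm y)\<^sup>2 - t * (1 - t) * (norm (x - y))\<^sup>2"
    unfolding power2_norm_eq_inner
    by (simp add: inner_add_left inner_add_right inner_diff_left inner_diff_right
        inner_commute[of y x]) algebra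
  moreover have "t * (1 - t) * (norm (x - y))\<^sup>2 > 0"
    using assms by simp
  moreover have "(1 - t) * (norm x)\<^sup>2 + t * (norm y)\<^sup>2 \<le> (1 - t) * r\<^sup>2 + t * r\<^sup>2"
    using assms by (intro add_mono mult_left_mono power_mono) auto
  moreover have "(1 - t) * r\<^sup>2 + t * r\<^sup>2 = r\<^sup>2"
    by algebra
  ultimately show "(norm ((1 - t) *\<^sub>R x + t *\<^sub>R y))\<^sup>2 < r\<^sup>2"
    by linarith
  show "0 \<le> r"
    using assms(1) norm_ge_zero order_trans by blast
qed

text \<open>Inside the ball of radius \<open>e\<close> the constant \<open>e\<close> suffices. The
  part of \<open>K\<close> outside is compact and avoids 0, so \<open>u\<close> has a positive
  minimum on it, and a slope equal to the bound of \<open>K\<close> divided by that minimum is steep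
  enough. The intercept \<open>e\<close> can be arbitrarily small, which forces the infimum of these
  bounds to vanish at height 0.\<close>

lemma exposed_point_norm_bound:
  fixes K :: "'a::euclidean_space set"
  assumes "compact K" and pos: "\<And>y. y \<in> K \<Longrightarrow> y \<noteq> 0 \<Longrightarrow> 0 < u \<bullet> y" and "0 < e"
  obtains b where "0 \<le> b" "\<And>y. y \<in> K \<Longrightarrow> norm y \<le> e + b * (u \<bullet> y)"
proof -
  define L where "L = K \<inter> {y. e \<le> norm y}"
  have nonneg: "0 \<le> u \<bullet> y" if "y \<in> K" for y
    using pos[OF that] by (cases "y = 0") auto
  have "compact L"
    unfolding L_def by (intro compact_Int_closed assms closed_Collect_le continuous_intros)
  show thesis
  proof (cases "L = {}")
    case True
    then have "\<And>y. y \<in> K \<Longrightarrow> norm y \<le> e + 0 * (u \<bullet> y)"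
      unfolding L_def by fastforce
    then show thesis
      using that[of 0] by simp
  next
    case False
    have "continuous_on L (\<lambda>y. u \<bullet> y)"
      by (intro continuous_intros)
    then obtain z where z: "z \<in> L" "\<And>y. y \<in> L \<Longrightarrow> u \<bullet> z \<le> u \<bullet> y"
      using continuous_attains_inf[OF \<open>compact L\<close> False] by blast
    have "0 < u \<bullet> z"
      using z(1) pos \<open>0 < e\<close> unfolding L_def by fastforce
    obtain D where D: "0 < D" "\<And>y. y \<in> K \<Longrightarrow> norm y \<le> D"
      using compact_imp_bounded[OF \<open>compact K\<close>] unfolding bounded_pos by blast
    have "norm y \<le> e + D / (u \<bullet> z) * (u \<bullet> y)" if "y \<in> K" for y
    proof (cases "y \<in> L")
      case True
      have "norm y \<le> D / (u \<bullet> z) * (u \<bullet> z)"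
        using D(2)[OF that] \<open>0 < u \<bullet> z\<close> by simp
      also have "\<dots> \<le> D / (u \<bullet> z) * (u \<bullet> y)"
        using z(2)[OF True] \<open>0 < D\<close> \<open>0 < u \<bullet> z\<close> by (intro mult_left_mono) auto
      finally show ?thesis
        using \<open>0 < e\<close> by linarith
    next
      case False
      then have "norm y \<le> e"
        using that unfolding L_def by auto
      then show ?thesis
        using nonneg[OF that] D(1) \<open>0 < u \<bullet> z\<close>
        by (smt (verit) divide_nonneg_pos mult_nonneg_nonneg)
    qed
    then show thesis
      using that[of "D / (u \<bullet> z)"] D(1) \<open>0 < u \<bullet> z\<close> by simp
  qed
qed

text \<open>The domain is \<open>{y. 0 < s \<and> norm y < F s + sqrt s}\<close> with \<open>s = u \<bullet> y\<close>, where \<open>F\<close> is the infimum of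
  the affine functions of \<open>s\<close> that bound \<open>norm\<close> on \<open>K\<close>. The square root makes the concave \<open>F\<close> strictly
  concave, and exposedness gives \<open>F 0 = 0\<close>, so that the closure meets \<open>s = 0\<close> only at the origin.\<close>

lemma exposed_point_strictly_convex_superset:
  fixes K :: "'a::euclidean_space set"
  assumes "compact K" and pos: "\<And>y. y \<in> K \<Longrightarrow> y \<noteq> 0 \<Longrightarrow> 0 < u \<bullet> y" and ne: "K - {0} \<noteq> {}"
  obtains \<omega> where "is_domain \<omega>" "bounded \<omega>" "strictly_convex \<omega>" "K - {0} \<subseteq> \<omega>" "0 \<notin> \<omega>"
proof -
  \<comment> \<open>A pair holds the intercept and the slope of an affine bound. Nonnegative slopes
    keep the values at \<open>s \<ge> 0\<close> bounded below by 0, so that the infimum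
    \<open>F s\<close> is meaningful there.\<close>
  define A where "A = {p::real \<times> real. 0 < fst p \<and> 0 \<le> snd p \<and> (\<forall>y\<in>K. norm y \<le> fst p + snd p * (u \<bullet> y))}"
  define F where "F = (\<lambda>s. INF p\<in>A. fst p + snd p * s)"
  define \<omega> where "\<omega> = {y. 0 < u \<bullet> y \<and> norm y < F (u \<bullet> y) + sqrt (u \<bullet> y)}"
  \<comment> \<open>A superset of the closure of \<open>\<omega>\<close>. Stating all the affine
    bounds instead of their infimum makes it closed without any appeal to continuity of
    \<open>F\<close> at 0.\<close>
  define T where "T = {y. 0 \<le> u \<bullet> y \<and> (\<forall>p\<in>A. norm y \<le> fst p + snd p * (u \<bullet> y) + sqrt (u \<bullet> y))}"
  obtain D where D: "0 < D" "\<And>y. y \<in> K \<Longrightarrow> norm y \<le> D"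
    using compact_imp_bounded[OF \<open>compact K\<close>] unfolding bounded_pos by blast
  have DA: "(D, 0) \<in> A"
    unfolding A_def using D by auto
  then have Ane: "A \<noteq> {}" by blast
  have bdd: "bdd_below ((\<lambda>p. fst p + snd p * s) ` A)" if "0 \<le> s" for s
    unfolding A_def using that by (intro bdd_belowI2[where m=0]) auto
  have Fle: "F s \<le> fst p + snd p * s" if "0 \<le> s" "p \<in> A" for s p
    unfolding F_def using bdd that by (intro cINF_lower) auto
  have Fge: "m \<le> F s" if "\<And>p. p \<in> A \<Longrightarrow> m \<le> fst p + snd p * s" for s m
    unfolding F_def using Ane that by (intro cINF_greatest) auto
  have Fconc: "(1 - t) * F r + t * F s \<le> F ((1 - t) * r + t * s)"
    if "0 \<le> r" "0 \<le> s" "0 \<le> t" "t \<le> 1" for r s t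
  proof (rule Fge)
    fix p assume "p \<in> A"
    then have "(1 - t) * F r + t * F s \<le> (1 - t) * (fst p + snd p * r) + t * (fst p + snd p * s)"
      using that by (intro add_mono mult_left_mono Fle) auto
    also have "\<dots> = fst p + snd p * ((1 - t) * r + t * s)"
      by (simp add: algebra_simps)
    finally show "(1 - t) * F r + t * F s \<le> fst p + snd p * ((1 - t) * r + t * s)" .
  qed
  \<comment> \<open>Continuity of \<open>F\<close> comes from concavity on an open half-line;
    positive heights are all that openness of \<open>\<omega>\<close> requires.\<close>
  have "convex_on {0<..} (\<lambda>s. - F s)"
  proof (intro convex_onI)
    fix t r s :: real assume "0 < t" "t < 1" "r \<in> {0<..}" "s \<in> {0<..}"
    then show "- F ((1 - t) *\<^sub>R r + t *\<^sub>R s) \<le> (1 - t) * - F r + t * - F s"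
      using Fconc[of r s t] by simp
  qed simp
  then have "continuous_on {0<..} (\<lambda>s. - (- F s))"
    by (intro continuous_on_minus convex_on_continuous) auto
  then have Fcont: "continuous_on {0<..} F" by simp
  have "open ({y. 0 < u \<bullet> y} \<inter> (\<lambda>y. F (u \<bullet> y) + sqrt (u \<bullet> y) - norm y) -` {0<..})"
    by (intro continuous_open_preimage continuous_intros open_Collect_less
        continuous_on_compose2[OF Fcont]) auto
  moreover have "\<omega> = {y. 0 < u \<bullet> y} \<inter> (\<lambda>y. F (u \<bullet> y) + sqrt (u \<bullet> y) - norm y) -` {0<..}"
    unfolding \<omega>_def by auto
  ultimately have "open \<omega>" by simp
  have "T = {y. 0 \<le> u \<bullet> y} \<inter> (\<Inter>p\<in>A. {y. norm y \<le> fst p + snd p * (u \<bullet> y) + sqrt (u \<bullet> y)})"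
    unfolding T_def by auto
  moreover have "closed \<dots>"
    by (intro closed_Int closed_INT ballI closed_Collect_le continuous_intros)
  ultimately have "closed T" by simp
  moreover have "\<omega> \<subseteq> T"
    unfolding \<omega>_def T_def using Fle by (fastforce dest: less_imp_le)
  ultimately have clT: "closure \<omega> \<subseteq> T"
    by (rule closure_minimal[rotated])
  have T_le: "norm y \<le> F (u \<bullet> y) + sqrt (u \<bullet> y)" if "y \<in> T" for y
    using Fge[of "norm y - sqrt (u \<bullet> y)" "u \<bullet> y"] that unfolding T_def by force
  \<comment> \<open>This is where exposedness enters: at height 0 both the slope term and the square
    root vanish, leaving only the intercept, which can be any \<open>e > 0\<close>.\<close>
  have T0: "y = 0" if "y \<in> T" "u \<bullet> y = 0" for y
  proof -
    have "norm y \<le> e" if "0 < e" for e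
    proof -
      obtain b where "0 \<le> b" "\<And>y. y \<in> K \<Longrightarrow> norm y \<le> e + b * (u \<bullet> y)"
        using exposed_point_norm_bound[OF \<open>compact K\<close> pos \<open>0 < e\<close>] by blast
      then have "(e, b) \<in> A"
        unfolding A_def using \<open>0 < e\<close> by auto
      then show ?thesis
        using \<open>y \<in> T\<close> \<open>u \<bullet> y = 0\<close> unfolding T_def by force
    qed
    then have "norm y \<le> 0"
      by (rule dense_ge)
    then show ?thesis by simp
  qed
  have strict: "(1 - t) *\<^sub>R x + t *\<^sub>R y \<in> \<omega>"
    if "x \<in> T" "y \<in> T" "x \<noteq> y" "0 < t" "t < 1" for x y t
  proof -
    define r where "r = u \<bullet> x"
    define s where "s = u \<bullet> y"
    have rs: "0 \<le> r" "0 \<le> s"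
      using that unfolding r_def s_def T_def by auto
    \<comment> \<open>Two points at height 0 would both be the origin, so the segment between
      distinct points has positive height in its interior.\<close>
    have "0 < r \<or> 0 < s"
    proof (rule ccontr)
      assume "\<not> (0 < r \<or> 0 < s)"
      then have "x = 0" "y = 0"
        using T0[of x] T0[of y] rs that unfolding r_def s_def by auto
      then show False using that by simp
    qed
    then have m0: "0 < (1 - t) * r + t * s"
      using rs that by (auto intro: add_pos_nonneg add_nonneg_pos)
    have "norm ((1 - t) *\<^sub>R x + t *\<^sub>R y) < F ((1 - t) * r + t * s) + sqrt ((1 - t) * r + t * s)"
    \<comment> \<open>At equal heights both points lie in one ball, and strictness comes from the
      norm; at different heights it comes from the square root.\<close>
    proof (cases "r = s")
      case True
      then have "(1 - t) * r + t * s = r" by (simp add: algebra_simps)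
      then show ?thesis
        using norm_convex_combination_less[of x "F r + sqrt r" y t] that T_le[of x] T_le[of y] True
        unfolding r_def s_def by simp
    next
      case False
      have "norm ((1 - t) *\<^sub>R x + t *\<^sub>R y) \<le> (1 - t) * norm x + t * norm y"
        using norm_triangle_ineq[of "(1 - t) *\<^sub>R x" "t *\<^sub>R y"] that by simp
      also have "\<dots> \<le> (1 - t) * (F r + sqrt r) + t * (F s + sqrt s)"
        using that T_le unfolding r_def s_def by (intro add_mono mult_left_mono) auto
      also have "\<dots> = ((1 - t) * F r + t * F s) + ((1 - t) * sqrt r + t * sqrt s)"
        by (simp add: algebra_simps)
      also have "\<dots> < F ((1 - t) * r + t * s) + sqrt ((1 - t) * r + t * s)"
        using Fconc[OF rs, of t] sqrt_strictly_concave[OF rs False, of t] that by simp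
      finally show ?thesis .
    qed
    then show ?thesis
      using m0 unfolding \<omega>_def r_def s_def by (simp add: inner_add_right)
  qed
  have sc: "strictly_convex \<omega>"
    unfolding strictly_convex_def using strict clT by blast
  have "convex \<omega>"
    unfolding convex_alt
  proof (intro ballI allI impI)
    fix x y t assume xy: "x \<in> \<omega>" "y \<in> \<omega>" and t: "0 \<le> t \<and> t \<le> (1::real)"
    show "(1 - t) *\<^sub>R x + t *\<^sub>R y \<in> \<omega>"
    proof (cases "x = y \<or> t = 0 \<or> t = 1")
      case True
      then show ?thesis
        using xy by (auto simp flip: scaleR_left.add)
    next
      case False
      then show ?thesis
        using strict[of x y t] xy t \<open>\<omega> \<subseteq> T\<close> by auto
    qed
  qed
  have sub: "K - {0} \<subseteq> \<omega>"
  proof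
    fix y assume y: "y \<in> K - {0}"
    then have "0 < u \<bullet> y" using pos by auto
    moreover have "norm y \<le> F (u \<bullet> y)"
      using y unfolding A_def by (intro Fge) (auto simp: A_def)
    ultimately show "y \<in> \<omega>"
      unfolding \<omega>_def using real_sqrt_gt_zero[of "u \<bullet> y"] by (intro CollectI conjI) linarith+
  qed
  \<comment> \<open>The constant bound \<open>D\<close> controls \<open>F\<close>, and the
    arithmetic-geometric mean inequality bounds the square root by
    \<open>(norm u + norm y) / 2\<close>, half of \<open>norm y\<close> being absorbed on the
    left.\<close>
  have "norm y \<le> 2 * D + norm u" if "y \<in> \<omega>" for y
  proof -
    have y: "0 < u \<bullet> y" "norm y < F (u \<bullet> y) + sqrt (u \<bullet> y)"
      using that unfolding \<omega>_def by auto
    have "F (u \<bullet> y) \<le> D"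
      using Fle[OF _ DA, of "u \<bullet> y"] y(1) by simp
    moreover have "sqrt (u \<bullet> y) \<le> sqrt (norm u * norm y)"
      using norm_cauchy_schwarz by simp
    moreover have "sqrt (norm u * norm y) \<le> (norm u + norm y) / 2"
      by (rule arith_geo_mean_sqrt) auto
    ultimately show ?thesis
      using y(2) by argo
  qed
  then have "bounded \<omega>"
    unfolding bounded_iff by blast
  moreover have "is_domain \<omega>"
    unfolding is_domain_def using sub ne \<open>open \<omega>\<close> convex_connected[OF \<open>convex \<omega>\<close>] by blast
  moreover have "0 \<notin> \<omega>" unfolding \<omega>_def by simp
  ultimately show thesis
    using that sc sub by blast
qed

lemma strictly_convex_translation:
  fixes S :: "'a::real_normed_vector set"
  assumes "strictly_convex S"
  shows "strictly_convex ((+) a ` S)"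
  unfolding strictly_convex_def closure_translation
proof (intro ballI allI impI)
  fix p q t
  assume "p \<in> (+) a ` closure S" "q \<in> (+) a ` closure S" and t: "p \<noteq> q \<and> 0 < t \<and> t < (1::real)"
  then obtain y z where y: "p = a + y" "y \<in> closure S" and z: "q = a + z" "z \<in> closure S"
    by blast
  then have "(1 - t) *\<^sub>R y + t *\<^sub>R z \<in> S"
    using assms t unfolding strictly_convex_def by simp
  moreover have "(1 - t) *\<^sub>R p + t *\<^sub>R q = a + ((1 - t) *\<^sub>R y + t *\<^sub>R z)"
    unfolding y z by (simp add: algebra_simps)
  ultimately show "(1 - t) *\<^sub>R p + t *\<^sub>R q \<in> (+) a ` S" by simp
qed

section \<open>Flat pieces of the frontier\<close>

text \<open>Trades \<open>Max\<close> for a condition on each single flat piece;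
  \<open>V = {0}\<close> shows that the maximum runs over a nonempty set.\<close>

lemma flat_dim_at_le_iff:
  fixes \<Omega> :: "(real ^ 'n::finite) set"
  assumes "x \<in> frontier \<Omega>"
  shows "flat_dim_at \<Omega> x \<le> k \<longleftrightarrow>
    (\<forall>V \<delta>. subspace V \<and> dim V \<le> CARD('n) - 1 \<and> 0 < \<delta> \<and>
       (\<lambda>v. x + v) ` (V \<inter> ball 0 \<delta>) \<subseteq> frontier \<Omega> \<longrightarrow> dim V \<le> k)"
proof -
  define M where "M = {m. m \<le> CARD('n) - 1 \<and>
        (\<exists>V \<delta>. subspace V \<and> dim V = m \<and> 0 < \<delta> \<and>
           (\<lambda>v. x + v) ` (V \<inter> ball 0 \<delta>) \<subseteq> frontier \<Omega>)}"
  have "finite M"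
    unfolding M_def by (rule finite_subset[of _ "{..CARD('n) - 1}"]) auto
  moreover have "0 \<in> M"
    unfolding M_def using assms by (auto intro!: exI[of _ "{0}"] exI[of _ "1::real"])
  ultimately have "Max M \<le> k \<longleftrightarrow> (\<forall>m\<in>M. m \<le> k)"
    by (intro Max_le_iff) auto
  moreover have "(\<forall>m\<in>M. m \<le> k) \<longleftrightarrow>
    (\<forall>V \<delta>. subspace V \<and> dim V \<le> CARD('n) - 1 \<and> 0 < \<delta> \<and>
       (\<lambda>v. x + v) ` (V \<inter> ball 0 \<delta>) \<subseteq> frontier \<Omega> \<longrightarrow> dim V \<le> k)"
    unfolding M_def by blast
  ultimately show ?thesis
    unfolding flat_dim_at_def M_def[symmetric] by simp
qed

lemma flat_dim_le_iff:
  fixes \<Omega> :: "(real ^ 'n::finite) set"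
  assumes "frontier \<Omega> \<noteq> {}"
  shows "flat_dim \<Omega> \<le> k \<longleftrightarrow>
    (\<forall>x\<in>frontier \<Omega>. \<forall>V \<delta>. subspace V \<and> dim V \<le> CARD('n) - 1 \<and> 0 < \<delta> \<and>
       (\<lambda>v. x + v) ` (V \<inter> ball 0 \<delta>) \<subseteq> frontier \<Omega> \<longrightarrow> dim V \<le> k)"
proof -
  \<comment> \<open>The frontier may be infinite, but the dimensions take only finitely many values,
    so the outer \<open>Max\<close> is meaningful.\<close>
  have "flat_dim_at \<Omega> ` frontier \<Omega> \<subseteq> {..CARD('n) - 1}"
    using flat_dim_at_le_iff[of _ \<Omega> "CARD('n) - 1"] by auto
  then have "finite (flat_dim_at \<Omega> ` frontier \<Omega>)"
    by (rule finite_subset) simp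
  then have "flat_dim \<Omega> \<le> k \<longleftrightarrow> (\<forall>x\<in>frontier \<Omega>. flat_dim_at \<Omega> x \<le> k)"
    unfolding flat_dim_def using assms by (subst Max_le_iff) auto
  then show ?thesis
    using flat_dim_at_le_iff[of _ \<Omega> k] by simp
qed

text \<open>A small step from \<open>y\<close> against \<open>a\<close> stays in the open set and
  lowers the functional, so the bound cannot be attained at \<open>y\<close>.\<close>

lemma open_supporting_functional_less:
  fixes a :: "'a::real_inner"
  assumes "open S" "a \<noteq> 0" "\<And>y. y \<in> S \<Longrightarrow> b \<le> a \<bullet> y" "y \<in> S"
  shows "b < a \<bullet> y"
proof -
  obtain e where e: "0 < e" "cball y e \<subseteq> S"
    using assms open_contains_cball by blast
  define z where "z = y - (e / norm a) *\<^sub>R a"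
  have "z \<in> cball y e"
    using e \<open>a \<noteq> 0\<close> unfolding z_def by (simp add: dist_norm)
  then have "b \<le> a \<bullet> z"
    using assms(3) e(2) by blast
  moreover have "a \<bullet> z = a \<bullet> y - (e / norm a) * (a \<bullet> a)"
    unfolding z_def by (simp add: inner_diff_right)
  moreover have "0 < (e / norm a) * (a \<bullet> a)"
    using e \<open>a \<noteq> 0\<close> by simp
  ultimately show ?thesis by linarith
qed

text \<open>Around a relative interior point \<open>z\<close> the face is itself a flat piece of
  full face dimension. The point \<open>x\<close> may lie on the relative boundary of the face,
  which is why the bound uses \<open>flat_dim\<close> rather than \<open>flat_dim_at\<close> at
  \<open>x\<close>.\<close>

lemma dim_supporting_face_le_flat_dim:
  fixes \<Omega> :: "(real ^ 'n::finite) set"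
  assumes "open \<Omega>" "convex \<Omega>" "x \<in> frontier \<Omega>" "a \<noteq> 0"
    and supp: "\<And>y. y \<in> closure \<Omega> \<Longrightarrow> a \<bullet> x \<le> a \<bullet> y"
  shows "dim ((\<lambda>y. y - x) ` {y \<in> closure \<Omega>. a \<bullet> y = a \<bullet> x}) \<le> flat_dim \<Omega>"
proof -
  define G where "G = {y \<in> closure \<Omega>. a \<bullet> y = a \<bullet> x}"
  have "G = closure \<Omega> \<inter> {y. a \<bullet> y = a \<bullet> x}" unfolding G_def by auto
  then have "convex G"
    using \<open>convex \<Omega>\<close> by (simp add: convex_Int convex_hyperplane convex_closure)
  have "x \<in> G"
    using assms(3) unfolding G_def frontier_def by auto
  have GsubF: "G \<subseteq> frontier \<Omega>"
  proof
    fix y assume y: "y \<in> G"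
    have "y \<notin> \<Omega>"
      using open_supporting_functional_less[OF \<open>open \<Omega>\<close> \<open>a \<noteq> 0\<close>, of "a \<bullet> x" y] supp
        closure_subset[of \<Omega>] y unfolding G_def by auto
    then show "y \<in> frontier \<Omega>"
      using y \<open>open \<Omega>\<close> unfolding G_def frontier_def by (simp add: interior_open)
  qed
  obtain z e where z: "z \<in> G" "0 < e" "ball z e \<inter> affine hull G \<subseteq> G"
    using \<open>convex G\<close> \<open>x \<in> G\<close> rel_interior_eq_empty[of G] mem_rel_interior_ball by blast
  define V where "V = (\<lambda>y. y - z) ` (affine hull G)"
  have subV: "subspace V"
    unfolding V_def using z(1) by (intro affine_diffs_subspace_subtract) (auto simp: hull_inc)
  have "affine hull G \<subseteq> {y. a \<bullet> y = a \<bullet> x}"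
    by (rule hull_minimal) (auto simp: G_def affine_hyperplane)
  then have "V \<subseteq> {v. a \<bullet> v = 0}"
    using z(1) unfolding V_def G_def by (auto simp: inner_diff_right)
  \<comment> \<open>Flat pieces are counted only up to dimension N - 1; lying in a hyperplane
    secures this.\<close>
  then have dimV: "dim V \<le> CARD('n) - 1"
    using dim_subset[of V "{v. a \<bullet> v = 0}"] dim_hyperplane[OF \<open>a \<noteq> 0\<close>] by simp
  have "(\<lambda>v. z + v) ` (V \<inter> ball 0 e) \<subseteq> frontier \<Omega>"
  proof
    fix w assume "w \<in> (\<lambda>v. z + v) ` (V \<inter> ball 0 e)"
    then have "w \<in> affine hull G" "w \<in> ball z e"
      unfolding V_def by (auto simp: dist_norm norm_minus_commute)
    then show "w \<in> frontier \<Omega>"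
      using z(3) GsubF by blast
  qed
  then have "dim V \<le> flat_dim \<Omega>"
    using flat_dim_le_iff[of \<Omega> "flat_dim \<Omega>"] assms(3) subV dimV z GsubF by blast
  moreover have "(\<lambda>y. y - x) ` G \<subseteq> V"
  proof
    fix w assume "w \<in> (\<lambda>y. y - x) ` G"
    then obtain y where y: "y \<in> G" "w = y - x" by blast
    then have "y - z \<in> V" "x - z \<in> V"
      unfolding V_def using \<open>x \<in> G\<close> by (auto simp: hull_inc)
    then have "(y - z) - (x - z) \<in> V"
      using subV subspace_diff by blast
    then show "w \<in> V" using y by simp
  qed
  then have "dim ((\<lambda>y. y - x) ` G) \<le> dim V" by (rule dim_subset)
  ultimately show ?thesis unfolding G_def by linarith
qed

section \<open>Rotated cylinders\<close>

text \<open>An orthogonal basis of \<open>V\<close> together with \<open>a\<close> extends to an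
  orthogonal basis of the whole space. The columns indexed by \<open>range \<iota>\<close> receive j
  normalised basis vectors outside \<open>V\<close>, with \<open>a\<close> among them; the remaining
  columns are then orthogonal to \<open>a\<close>.\<close>

lemma obtain_adapted_orthogonal_matrix:
  fixes V :: "(real ^ 'n::finite) set" and \<iota> :: "'j::finite \<Rightarrow> 'n"
  assumes "inj \<iota>" "subspace V" "dim V + CARD('j) \<le> CARD('n)" "a \<noteq> 0"
    and aV: "\<And>v. v \<in> V \<Longrightarrow> a \<bullet> v = 0"
  obtains U :: "real ^ 'n ^ 'n" where "orthogonal_matrix U"
    "\<And>i v. v \<in> V \<Longrightarrow> column (\<iota> i) U \<bullet> v = 0"
    "\<And>k. k \<notin> range \<iota> \<Longrightarrow> column k U \<bullet> a = 0"
proof -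
  obtain B1 where B1: "0 \<notin> B1" "B1 \<subseteq> V" "pairwise orthogonal B1" "independent B1"
      "card B1 = dim V" "span B1 = V"
    using orthogonal_basis_subspace[OF \<open>subspace V\<close>] by metis
  have "pairwise orthogonal (insert a B1)"
    using B1 aV by (auto simp: pairwise_insert orthogonal_def inner_commute)
  then obtain B' where B': "B' \<inter> insert 0 (insert a B1) = {}"
      "pairwise orthogonal (insert a B1 \<union> B')" "span (insert a B1 \<union> B') = span (insert a B1 \<union> UNIV)"
    using orthogonal_extension_strong[of "insert a B1" UNIV] by metis
  define B where "B = insert a B1 \<union> B'"
  have B: "pairwise orthogonal B" "0 \<notin> B" "span B = UNIV" "a \<in> B" "B1 \<subseteq> B"
    using B' B1 \<open>a \<noteq> 0\<close> unfolding B_def by auto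
  then have "independent B"
    using pairwise_orthogonal_independent by blast
  then have finB: "finite B" and cardB: "card B = CARD('n)"
    using B(3) dim_span_eq_card_independent[of B] by (auto simp: independent_imp_finite)
  have "a \<notin> B1"
    using aV B1(2) \<open>a \<noteq> 0\<close> inner_eq_zero_iff by blast
  have "card (B - B1) = CARD('n) - dim V"
    using B(5) B1(5) cardB finB by (simp add: card_Diff_subset finite_subset)
  \<comment> \<open>There is room for this choice: \<open>B - B1\<close> has N -
    \<open>dim V\<close> elements, at least j, and j is at least 1, so \<open>a\<close> can be
    included.\<close>
  then have "\<exists>B2. {a} \<subseteq> B2 \<and> B2 \<subseteq> B - B1 \<and> card B2 = CARD('j)"
    using assms(3) \<open>a \<notin> B1\<close> B(4) finB by (intro exists_subset_between) (auto simp: Suc_le_eq)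
  then obtain B2 where B2: "a \<in> B2" "B2 \<subseteq> B - B1" "card B2 = CARD('j)" by auto
  have card_range: "card (range \<iota>) = CARD('j)"
    using \<open>inj \<iota>\<close> by (simp add: card_image)
  obtain f where f: "bij_betw f (range \<iota>) B2"
    using finite_same_card_bij[of "range \<iota>" B2] B2 card_range finB
    by (metis finite finite_Diff finite_subset)
  have "card (- range \<iota>) = card (B - B2)"
    using B2 card_range cardB finB
    by (metis Compl_eq_Diff_UNIV Diff_subset card_Diff_subset finite finite_subset subset_UNIV
        subset_trans)
  then obtain g where g: "bij_betw g (- range \<iota>) (B - B2)"
    using finite_same_card_bij[of "- range \<iota>" "B - B2"] finB by auto
  define h where "h k = (if k \<in> range \<iota> then f k else g k)" for k
  have "bij_betw h (range \<iota> \<union> - range \<iota>) (B2 \<union> (B - B2))"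
    unfolding h_def using f g by (intro bij_betw_disjoint_Un) auto
  then have h: "bij_betw h UNIV B"
    using B2 by (simp add: Un_absorb1 subset_Diff_insert Diff_subset subset_trans[of B2 "B - B1" B])
  have hB: "h k \<in> B" for k
    using bij_betwE[OF h] by simp
  then have h0: "h k \<noteq> 0" for k
    using B(2) by metis
  have horth: "h k \<bullet> b = 0" if "b \<in> B" "b \<noteq> h k" for k b
    using B(1) hB that unfolding pairwise_def orthogonal_def by metis
  define U :: "real ^ 'n ^ 'n" where "U = (\<chi> i k. (h k /\<^sub>R norm (h k)) $ i)"
  have col: "column k U = h k /\<^sub>R norm (h k)" for k
    unfolding U_def column_def by (simp add: vec_eq_iff)
  have "orthogonal_matrix U"
    unfolding orthogonal_matrix_orthonormal_columns col
  proof (intro conjI allI impI)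
    fix i k :: 'n assume "i \<noteq> k"
    then have "h i \<noteq> h k"
      using h by (auto simp: bij_betw_def inj_def)
    then show "orthogonal (h i /\<^sub>R norm (h i)) (h k /\<^sub>R norm (h k))"
      using horth[OF hB[of k]] by (simp add: orthogonal_def)
  qed (use h0 in auto)
  moreover have "column (\<iota> i) U \<bullet> v = 0" if "v \<in> V" for i v
  proof -
    have "h (\<iota> i) \<in> B2"
      using f unfolding h_def by (auto dest: bij_betwE)
    then have "orthogonal (h (\<iota> i)) b" if "b \<in> B1" for b
      using horth[of b "\<iota> i"] B(5) B2(2) that unfolding orthogonal_def by auto
    then have "orthogonal (h (\<iota> i)) v"
      using orthogonal_to_span[of v B1] that B1(6) by auto
    then show ?thesis
      unfolding col orthogonal_def by simp
  qed
  moreover have "column k U \<bullet> a = 0" if "k \<notin> range \<iota>" for k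
  proof -
    have "h k \<notin> B2"
      using that g unfolding h_def by (auto dest: bij_betwE)
    then show ?thesis
      unfolding col using horth[OF B(4), of k] B2(1) by auto
  qed
  ultimately show thesis using that by blast
qed

lemma mem_orthogonal_matrix_image_iff:
  fixes U :: "real ^ 'n::finite ^ 'n"
  assumes "orthogonal_matrix U"
  shows "y \<in> (*v) U ` S \<longleftrightarrow> transpose U *v y \<in> S"
proof -
  have "transpose U ** U = mat 1" "U ** transpose U = mat 1"
    using assms unfolding orthogonal_matrix_def by auto
  then have "transpose U *v (U *v z) = z" "U *v (transpose U *v z) = z" for z
    by (metis matrix_vector_mul_assoc matrix_vector_mul_lid)+
  then show ?thesis by (metis imageE image_eqI)
qed

text \<open>The coordinates of \<open>transpose U *v y\<close> are the inner products of
  \<open>y\<close> with the columns of \<open>U\<close>. Rotated cylinders thus become preimages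
  under a linear map to the j-dimensional space, the map called \<open>P\<close> below.\<close>

lemma mem_rotated_cylinder_iff:
  fixes U :: "real ^ 'n::finite ^ 'n" and \<iota> :: "'j::finite \<Rightarrow> 'n"
  assumes "orthogonal_matrix U"
  shows "y \<in> (*v) U ` cylinder \<iota> \<omega> \<longleftrightarrow> (\<chi> i. column (\<iota> i) U \<bullet> y) \<in> \<omega>"
proof -
  have "(transpose U *v y) $ k = column k U \<bullet> y" for k
    by (simp add: matrix_vector_mult_def transpose_def column_def inner_vec_def)
  then show ?thesis
    unfolding mem_orthogonal_matrix_image_iff[OF assms] cylinder_def by simp
qed

lemma continuous_on_coordinate_inner:
  fixes c :: "'j::finite \<Rightarrow> 'a::real_inner"
  shows "continuous_on S (\<lambda>y. \<chi> i. c i \<bullet> y)"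
  by (intro continuous_on_vec_lambda continuous_intros)

lemma open_rotated_cylinder:
  fixes U :: "real ^ 'n::finite ^ 'n" and \<iota> :: "'j::finite \<Rightarrow> 'n"
  assumes "orthogonal_matrix U" "open \<omega>"
  shows "open ((*v) U ` cylinder \<iota> \<omega>)"
proof -
  have "(*v) U ` cylinder \<iota> \<omega> = (\<lambda>y. \<chi> i. column (\<iota> i) U \<bullet> y) -` \<omega>"
    using mem_rotated_cylinder_iff[OF assms(1)] by blast
  then show ?thesis
    using open_vimage[OF assms(2) continuous_on_coordinate_inner] by metis
qed

text \<open>The j columns of \<open>U\<close> indexed by \<open>range \<iota>\<close> are
  independent and, by strict convexity, orthogonal to every flat direction; comparing dimensions in
  the orthogonal complement of \<open>V\<close> gives the bound.\<close>

lemma flat_dim_le_if_cylinder_class: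
  fixes \<Omega> :: "(real ^ 'n::finite) set" and \<iota> :: "'j::finite \<Rightarrow> 'n"
  assumes "inj \<iota>" and cyl: "\<Omega> \<in> cylinder_class \<iota>"
  shows "flat_dim \<Omega> \<le> CARD('n) - CARD('j)"
proof -
  have "\<Omega> \<noteq> {}" "bounded \<Omega>"
    using cyl unfolding cylinder_class_def is_domain_def by auto
  then have "frontier \<Omega> \<noteq> {}"
    using frontier_eq_empty not_bounded_UNIV by blast
  moreover have "dim V \<le> CARD('n) - CARD('j)"
    if x: "x \<in> frontier \<Omega>" and V: "subspace V" "0 < \<delta>"
      and flat: "(\<lambda>v. x + v) ` (V \<inter> ball 0 \<delta>) \<subseteq> frontier \<Omega>" for x V \<delta>
  proof -
    obtain U :: "real ^ 'n ^ 'n" and \<omega> :: "(real ^ 'j) set" where U: "orthogonal_matrix U"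
      and \<omega>: "is_domain \<omega>" "strictly_convex \<omega>"
      and sub: "\<Omega> \<subseteq> (*v) U ` cylinder \<iota> \<omega>" and xf: "x \<in> frontier ((*v) U ` cylinder \<iota> \<omega>)"
      using cyl x unfolding cylinder_class_def model_cylinders_def by blast
    define P where "P = (\<lambda>y. (\<chi> i. column (\<iota> i) U \<bullet> y) :: real ^ 'j)"
    have Padd: "P (y + z) = P y + P z" "P (y - z) = P y - P z" "P (c *\<^sub>R y) = c *\<^sub>R P y" for y z c
      unfolding P_def by (simp_all add: vec_eq_iff inner_add_right inner_diff_right)
    have "x \<notin> (*v) U ` cylinder \<iota> \<omega>"
      using xf open_rotated_cylinder[OF U, of \<omega> \<iota>] \<omega>(1)
      unfolding frontier_def is_domain_def by (simp add: interior_open)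
    then have Px: "P x \<notin> \<omega>"
      using mem_rotated_cylinder_iff[OF U] unfolding P_def by blast
    have "P ` \<Omega> \<subseteq> \<omega>"
      using sub mem_rotated_cylinder_iff[OF U] unfolding P_def by blast
    then have "P ` closure \<Omega> \<subseteq> closure \<omega>"
      unfolding P_def
      by (intro image_closure_subset continuous_on_coordinate_inner closed_closure)
        (use closure_subset in blast)
    then have Pcl: "P y \<in> closure \<omega>" if "y \<in> closure \<Omega>" for y
      using that by blast
    have PV: "P v = 0" if "v \<in> V" for v
    proof (rule ccontr)
      assume "P v \<noteq> 0"
      then have "v \<noteq> 0" using Padd(3)[of 0 v] by auto
      \<comment> \<open>Rescaling to norm \<open>\<delta> / 2\<close> puts both \<open>x + w\<close>
        and \<open>x - w\<close> on the flat piece; their images have midpoint \<open>P x\<close>,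
        which strict convexity would place in \<open>\<omega>\<close>.\<close>
      define w where "w = (\<delta> / (2 * norm v)) *\<^sub>R v"
      have "w \<in> V" "- w \<in> V"
        unfolding w_def using V that by (auto simp: subspace_scale subspace_neg)
      moreover have "norm w < \<delta>"
        unfolding w_def using \<open>v \<noteq> 0\<close> V by simp
      ultimately have "x + w \<in> frontier \<Omega>" "x + - w \<in> frontier \<Omega>"
        using flat by auto
      then have cl: "P x + P w \<in> closure \<omega>" "P x - P w \<in> closure \<omega>"
        using Pcl[of "x + w"] Pcl[of "x - w"] Padd unfolding frontier_def by auto
      have "P w \<noteq> 0"
        unfolding w_def Padd using \<open>v \<noteq> 0\<close> V \<open>P v \<noteq> 0\<close> by simp
      then have "P x + P w \<noteq> P x - P w"
        by (auto simp: vec_eq_iff)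
      then have "(1 - 1/2) *\<^sub>R (P x + P w) + (1/2) *\<^sub>R (P x - P w) \<in> \<omega>"
        using \<omega>(2)[unfolded strictly_convex_def, rule_format, OF cl, of "1/2"] by simp
      moreover have "(1 - 1/2) *\<^sub>R (P x + P w) + (1/2) *\<^sub>R (P x - P w) = P x"
        by (simp add: vec_eq_iff field_simps)
      ultimately show False using Px by simp
    qed
    define E where "E = (\<lambda>i. column (\<iota> i) U) ` UNIV"
    have colU: "norm (column k U) = 1" "k \<noteq> l \<Longrightarrow> orthogonal (column k U) (column l U)" for k l
      using U unfolding orthogonal_matrix_orthonormal_columns by auto
    have "inj (\<lambda>i. column (\<iota> i) U)"
    proof (rule injI)
      fix i k assume eq: "column (\<iota> i) U = column (\<iota> k) U"
      have "column (\<iota> i) U \<noteq> 0"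
        using colU(1)[of "\<iota> i"] by auto
      then have "\<iota> i = \<iota> k"
        using colU(2)[of "\<iota> i" "\<iota> k"] eq by (auto simp: orthogonal_def)
      then show "i = k" using \<open>inj \<iota>\<close> by (simp add: inj_eq)
    qed
    then have "card E = CARD('j)"
      unfolding E_def by (rule card_image)
    moreover have "independent E"
    proof (rule pairwise_orthogonal_independent)
      show "pairwise orthogonal E"
        unfolding E_def by (rule pairwise_imageI) (use colU(2) in force)
      show "0 \<notin> E"
      proof
        assume "0 \<in> E"
        then obtain i where "column (\<iota> i) U = 0"
          unfolding E_def by auto
        then show False using colU(1)[of "\<iota> i"] by simp
      qed
    qed
    ultimately have "dim (span E) = CARD('j)"
      by (simp add: dim_eq_card_independent)
    moreover have "dim {y \<in> UNIV. \<forall>v\<in>V. orthogonal v y} + dim V = DIM(real ^ 'n)"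
      using dim_subspace_orthogonal_to_vectors[of V UNIV] V by simp
    moreover have "span E \<subseteq> {y \<in> UNIV. \<forall>v\<in>V. orthogonal v y}"
    proof (intro subsetI CollectI conjI ballI UNIV_I)
      fix y v assume "y \<in> span E" "v \<in> V"
      have "orthogonal v e" if "e \<in> E" for e
        using PV[OF \<open>v \<in> V\<close>] that unfolding P_def E_def orthogonal_def
        by (auto simp: vec_eq_iff inner_commute)
      then show "orthogonal v y"
        using orthogonal_to_span[OF \<open>y \<in> span E\<close>] by simp
    qed
    ultimately show ?thesis
      using dim_subset[of "span E" "{y \<in> UNIV. \<forall>v\<in>V. orthogonal v y}"] by simp
  qed
  ultimately show ?thesis
    unfolding flat_dim_le_iff[OF \<open>frontier \<Omega> \<noteq> {}\<close>] by blast
qed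

text \<open>A rotation adapted to the supporting face reduces the task to the j-dimensional space,
  where 0 is an exposed point of the projected compact set \<open>K\<close>, with exposing
  functional \<open>P a\<close>.\<close>

lemma exists_cylinder_at_frontier:
  fixes \<Omega> :: "(real ^ 'n::finite) set" and \<iota> :: "'j::finite \<Rightarrow> 'n"
  assumes "inj \<iota>" "is_domain \<Omega>" "bounded \<Omega>" "convex \<Omega>"
    and flat: "flat_dim \<Omega> \<le> CARD('n) - CARD('j)" and x: "x \<in> frontier \<Omega>"
  shows "\<exists>U :: real ^ 'n ^ 'n. \<exists>C\<in>model_cylinders \<iota>.
    orthogonal_matrix U \<and> \<Omega> \<subseteq> (*v) U ` C \<and> x \<in> frontier ((*v) U ` C)"
proof -
  have \<Omega>: "open \<Omega>" "\<Omega> \<noteq> {}"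
    using assms(2) unfolding is_domain_def by auto
  have x': "x \<in> closure \<Omega>" "x \<notin> \<Omega>"
    using x \<Omega> unfolding frontier_def by (auto simp: interior_open)
  obtain a b where a: "a \<noteq> 0" "a \<bullet> x \<le> b" "\<And>y. y \<in> \<Omega> \<Longrightarrow> b \<le> a \<bullet> y"
    using separating_hyperplane_sets[of "{x}" \<Omega>] \<open>convex \<Omega>\<close> \<Omega> x' by auto
  have "closure \<Omega> \<subseteq> {y. a \<bullet> x \<le> a \<bullet> y}"
    by (intro closure_minimal closed_halfspace_ge subsetI CollectI order_trans[OF a(2)] a(3))
  then have supp: "\<And>y. y \<in> closure \<Omega> \<Longrightarrow> a \<bullet> x \<le> a \<bullet> y" by blast
  \<comment> \<open>The supporting face moved to the origin; its span is the space of directions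
    that the projection must collapse.\<close>
  define G where "G = (\<lambda>y. y - x) ` {y \<in> closure \<Omega>. a \<bullet> y = a \<bullet> x}"
  have "dim (span G) \<le> CARD('n) - CARD('j)"
    using dim_supporting_face_le_flat_dim[OF \<Omega>(1) \<open>convex \<Omega>\<close> x a(1) supp] flat
    unfolding G_def by simp
  \<comment> \<open>Rules out truncation in the natural number difference, so that the bound can be
    rewritten as a sum.\<close>
  moreover have "CARD('j) \<le> CARD('n)"
    using \<open>inj \<iota>\<close> by (metis card_inj_on_le finite_class.finite_UNIV subset_UNIV)
  moreover have "a \<bullet> v = 0" if "v \<in> span G" for v
  proof -
    have "orthogonal a w" if "w \<in> G" for w
      using that unfolding G_def orthogonal_def by (auto simp: inner_diff_right)
    then show ?thesis
      using orthogonal_to_span[OF that, of a] unfolding orthogonal_def by simp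
  qed
  ultimately obtain U :: "real ^ 'n ^ 'n" where U: "orthogonal_matrix U"
    and UG: "\<And>i v. v \<in> span G \<Longrightarrow> column (\<iota> i) U \<bullet> v = 0"
    and Ua: "\<And>k. k \<notin> range \<iota> \<Longrightarrow> column k U \<bullet> a = 0"
    using obtain_adapted_orthogonal_matrix[OF \<open>inj \<iota>\<close> subspace_span[of G] _ a(1)]
    by (metis le_diff_conv2)
  define P where "P = (\<lambda>y. (\<chi> i. column (\<iota> i) U \<bullet> y) :: real ^ 'j)"
  have Padd: "P (y + z) = P y + P z" "P (y - z) = P y - P z" for y z
    unfolding P_def by (simp_all add: vec_eq_iff inner_add_right inner_diff_right)
  \<comment> \<open>The normal \<open>a\<close> has no component along the columns that
    \<open>P\<close> drops, so \<open>P\<close> preserves inner products with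
    \<open>a\<close>.\<close>
  have Pinner: "P a \<bullet> P y = a \<bullet> y" for y
  proof -
    have "orthogonal_transformation ((*v) (transpose U))"
      using U by (simp add: orthogonal_transformation_matrix orthogonal_matrix_transpose)
    then have "a \<bullet> y = (transpose U *v a) \<bullet> (transpose U *v y)"
      unfolding orthogonal_transformation_def by simp
    also have "\<dots> = (\<Sum>k\<in>UNIV. (column k U \<bullet> a) * (column k U \<bullet> y))"
      by (simp add: inner_vec_def matrix_vector_mult_def transpose_def column_def)
    also have "\<dots> = (\<Sum>k\<in>range \<iota>. (column k U \<bullet> a) * (column k U \<bullet> y))"
      using Ua by (intro sum.mono_neutral_right) auto
    also have "\<dots> = P a \<bullet> P y"
      unfolding P_def using \<open>inj \<iota>\<close> by (simp add: inner_vec_def sum.reindex)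
    finally show ?thesis by simp
  qed
  define K where "K = (\<lambda>y. P (y - x)) ` closure \<Omega>"
  have "continuous_on (closure \<Omega>) (\<lambda>y. P (y - x))"
    unfolding P_def by (intro continuous_on_vec_lambda continuous_intros)
  then have "compact K"
    unfolding K_def using \<open>bounded \<Omega>\<close> by (intro compact_continuous_image) auto
  have Kpos: "0 < P a \<bullet> z" if z: "z \<in> K" "z \<noteq> 0" for z
  proof -
    obtain y where y: "y \<in> closure \<Omega>" "z = P (y - x)"
      using z unfolding K_def by blast
    have "P a \<bullet> z = a \<bullet> y - a \<bullet> x"
      unfolding y(2) Pinner by (simp add: inner_diff_right)
    \<comment> \<open>Equality would put \<open>y\<close> in the face, whose directions from
      \<open>x\<close> are all sent to 0 by \<open>P\<close>.\<close>
    moreover have "a \<bullet> y \<noteq> a \<bullet> x"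
    proof
      assume "a \<bullet> y = a \<bullet> x"
      then have "y - x \<in> span G"
        using y unfolding G_def by (auto intro: span_base)
      then have "z = 0"
        unfolding y(2) P_def using UG by (simp add: vec_eq_iff)
      then show False using z by simp
    qed
    ultimately show ?thesis
      using supp[OF y(1)] by simp
  qed
  have Pne: "P (y - x) \<in> K - {0}" if "y \<in> \<Omega>" for y
  proof -
    have "a \<bullet> x < a \<bullet> y"
      using open_supporting_functional_less[OF \<Omega>(1) a(1), of "a \<bullet> x" y] supp
        closure_subset[of \<Omega>] that by blast
    then have "P a \<bullet> P (y - x) \<noteq> 0"
      unfolding Pinner by (simp add: inner_diff_right)
    then show ?thesis
      unfolding K_def using that closure_subset[of \<Omega>] by auto
  qed
  then have "K - {0} \<noteq> {}"
    using \<Omega>(2) by blast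
  then obtain \<omega> where \<omega>: "is_domain \<omega>" "bounded \<omega>" "strictly_convex \<omega>" "K - {0} \<subseteq> \<omega>" "0 \<notin> \<omega>"
    using exposed_point_strictly_convex_superset[OF \<open>compact K\<close> Kpos] by blast
  \<comment> \<open>The set \<open>K\<close> was centred at the image of \<open>x\<close>; the
    translation undoes this, since cylinders are rotated but not shifted.\<close>
  define \<omega>' where "\<omega>' = (+) (P x) ` \<omega>"
  have "is_domain \<omega>'"
    using \<omega>(1) unfolding \<omega>'_def is_domain_def
    by (auto intro!: open_translation connected_continuous_image continuous_intros)
  moreover have "bounded \<omega>'"
    using \<omega>(2) unfolding \<omega>'_def by (rule bounded_translation)
  moreover have "strictly_convex \<omega>'"
    unfolding \<omega>'_def using \<omega>(3) by (rule strictly_convex_translation)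
  ultimately have "cylinder \<iota> \<omega>' \<in> model_cylinders \<iota>" and "open \<omega>'"
    unfolding model_cylinders_def is_domain_def by auto
  have memC: "y \<in> (*v) U ` cylinder \<iota> \<omega>' \<longleftrightarrow> P (y - x) \<in> \<omega>" for y
  proof -
    have "y \<in> (*v) U ` cylinder \<iota> \<omega>' \<longleftrightarrow> P y \<in> \<omega>'"
      unfolding P_def by (rule mem_rotated_cylinder_iff[OF U])
    also have "\<dots> \<longleftrightarrow> P (y - x) \<in> \<omega>"
      unfolding \<omega>'_def Padd by (auto simp: image_iff algebra_simps intro!: bexI[of _ "P y - P x"])
    finally show ?thesis .
  qed
  have sub: "\<Omega> \<subseteq> (*v) U ` cylinder \<iota> \<omega>'"
    using Pne \<omega>(4) memC by blast
  have "P (x - x) = 0"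
    unfolding Padd by simp
  then have "x \<notin> (*v) U ` cylinder \<iota> \<omega>'"
    unfolding memC using \<omega>(5) by simp
  moreover have "x \<in> closure ((*v) U ` cylinder \<iota> \<omega>')"
    using closure_mono[OF sub] x'(1) by blast
  ultimately have "x \<in> frontier ((*v) U ` cylinder \<iota> \<omega>')"
    unfolding frontier_def using interior_subset by blast
  then show ?thesis
    using U sub \<open>cylinder \<iota> \<omega>' \<in> model_cylinders \<iota>\<close> by blast
qed

theorem theorem2:
  fixes \<Omega> :: "(real ^ 'n::finite) set" and \<iota> :: "'j::finite \<Rightarrow> 'n"
  assumes "inj \<iota>"
    and "is_domain \<Omega>" and "bounded \<Omega>" and "convex \<Omega>"
  shows "\<Omega> \<in> cylinder_class \<iota> \<longleftrightarrow> flat_dim \<Omega> \<le> CARD('n) - CARD('j)"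
proof
  assume "\<Omega> \<in> cylinder_class \<iota>"
  then show "flat_dim \<Omega> \<le> CARD('n) - CARD('j)"
    using flat_dim_le_if_cylinder_class[OF \<open>inj \<iota>\<close>] by blast
next
  assume "flat_dim \<Omega> \<le> CARD('n) - CARD('j)"
  then show "\<Omega> \<in> cylinder_class \<iota>"
    unfolding cylinder_class_def using assms exists_cylinder_at_frontier[OF assms] by blast
qed

end
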